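(* The only acyclic total zero-divisor graphs of the rings $\mathbb{Z}_m$ are $P_1$, $P_2$, $P_3$, $K_{1,2p-2}\cup 2K_1$ and $(p+q-2)K_1$, for any distinct prime numbers $p$ and $q$.
   Context: $\mathbb{Z}_m$ is the ring of integers modulo $m$, and $Z(\mathbb{Z}_m)$ is its set of zero-divisors, with $0$ included. The total zero-divisor graph of $\mathbb{Z}_m$ is the simple graph whose vertices are the nonzero zero-divisors of $\mathbb{Z}_m$, with distinct vertices $u,v$ adjacent if and only if $uv=0$ and $u+v\in Z(\mathbb{Z}_m)$. $P_k$ is the path with $k$ vertices, $K_{1,k}$ is the star with $k$ leaves, $kK_1$ is the edgeless graph on $k$ vertices, and $\cup$ denotes disjoint union. A graph is acyclic if it contains no cycle.
   Formalization: That K_{1,2p-2} ∪ 2K_1 occurs is claimed only for odd p: for p = 2 it has 5 vertices, and the only Z_m with 5 nonzero zero-divisors is Z_10, whose graph is 5K_1. Graphs are assumed to have a vertex, since for prime m the graph is empty, acyclic and not listed. *)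

theory Defs
  imports "HOL-Number_Theory.Residues" "Graph_Theory.Graph_Theory"
begin

text \<open>
  Simple graphs are symmetric, loop-free pair digraphs (locale \<^locale>\<open>pair_graph\<close>):
  the edge between \<open>u\<close> and \<open>v\<close> is represented by the two arcs \<open>(u, v)\<close> and \<open>(v, u)\<close>.
\<close>

definition zero_divisors :: "('a, 'b) ring_scheme \<Rightarrow> 'a set" where
  "zero_divisors R =
     {\<zero>\<^bsub>R\<^esub>} \<union> {x \<in> carrier R. \<exists>y \<in> carrier R. y \<noteq> \<zero>\<^bsub>R\<^esub> \<and> x \<otimes>\<^bsub>R\<^esub> y = \<zero>\<^bsub>R\<^esub>}"

definition total_zero_divisor_graph :: "('a, 'b) ring_scheme \<Rightarrow> 'a pair_pre_digraph" where
  "total_zero_divisor_graph R =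
     \<lparr>pverts = zero_divisors R - {\<zero>\<^bsub>R\<^esub>},
      parcs = {(u, v). u \<in> zero_divisors R - {\<zero>\<^bsub>R\<^esub>} \<and> v \<in> zero_divisors R - {\<zero>\<^bsub>R\<^esub>} \<and> u \<noteq> v \<and>
                 u \<otimes>\<^bsub>R\<^esub> v = \<zero>\<^bsub>R\<^esub> \<and> u \<oplus>\<^bsub>R\<^esub> v \<in> zero_divisors R}\<rparr>"

abbreviation tzd_graph_Z :: "nat \<Rightarrow> int pair_pre_digraph" where
  "tzd_graph_Z m \<equiv> total_zero_divisor_graph (residue_ring (int m))"

text \<open>
  The notion \<^const>\<open>pre_digraph.cycle\<close> counts the closed walk \<open>u, v, u\<close> along the two arcs of one
  edge as a cycle, so the library's \<^const>\<open>forest\<close> does not express acyclicity of an undirected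
  graph. The cycles of a simple graph are those of length at least three.
\<close>
definition acyclic_graph :: "'a pair_pre_digraph \<Rightarrow> bool" where
  "acyclic_graph G \<longleftrightarrow> \<not> (\<exists>p. pre_digraph.cycle (with_proj G) p \<and> 3 \<le> length p)"

abbreviation graph_iso :: "'a pair_pre_digraph \<Rightarrow> 'b pair_pre_digraph \<Rightarrow> bool" (infix \<open>\<cong>\<^sub>g\<close> 50) where
  "G \<cong>\<^sub>g H \<equiv> digraph_iso (with_proj G) (with_proj H)"

definition path_graph :: "nat \<Rightarrow> nat pair_pre_digraph" where
  "path_graph k =
     \<lparr>pverts = {..<k}, parcs = {(i, j). i < k \<and> j < k \<and> (j = Suc i \<or> i = Suc j)}\<rparr>"

definition star_graph :: "nat \<Rightarrow> nat pair_pre_digraph" where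
  "star_graph k = \<lparr>pverts = {0..k}, parcs = {0} \<times> {1..k} \<union> {1..k} \<times> {0}\<rparr>"

definition edgeless_graph :: "nat \<Rightarrow> nat pair_pre_digraph" where
  "edgeless_graph k = \<lparr>pverts = {..<k}, parcs = {}\<rparr>"

definition disjoint_union ::
    "'a pair_pre_digraph \<Rightarrow> 'b pair_pre_digraph \<Rightarrow> ('a + 'b) pair_pre_digraph" where
  "disjoint_union G H =
     \<lparr>pverts = pverts G <+> pverts H,
      parcs = map_prod Inl Inl ` parcs G \<union> map_prod Inr Inr ` parcs H\<rparr>"

lemma pair_graph_tzd_graph_Z:
  assumes "0 < m"
  shows "pair_graph (tzd_graph_Z m)"
proof -
  have sub: "zero_divisors (residue_ring (int m)) \<subseteq> {0..int m - 1}"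
    using assms by (auto simp: zero_divisors_def residue_ring_def)
  hence fin: "finite (pverts (tzd_graph_Z m))"
    by (auto simp: total_zero_divisor_graph_def intro: finite_subset)
  have "parcs (tzd_graph_Z m) \<subseteq> pverts (tzd_graph_Z m) \<times> pverts (tzd_graph_Z m)"
    by (auto simp: total_zero_divisor_graph_def)
  hence fin': "finite (parcs (tzd_graph_Z m))"
    using fin finite_subset by blast
  show ?thesis
    by unfold_locales
      (use fin fin' in \<open>auto simp: total_zero_divisor_graph_def residue_ring_def symmetric_conv
        mult.commute add.commute\<close>)
qed

lemma pair_graph_path_graph: "pair_graph (path_graph k)"
proof -
  have "parcs (path_graph k) \<subseteq> {..<k} \<times> {..<k}"
    by (auto simp: path_graph_def)
  hence "finite (parcs (path_graph k))"
    using finite_subset by blast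
  thus ?thesis
    by unfold_locales (auto simp: path_graph_def symmetric_conv)
qed

lemma pair_graph_star_graph: "pair_graph (star_graph k)"
  by unfold_locales (auto simp: star_graph_def symmetric_def sym_def arcs_ends_conv)

lemma complete_bipartite_star_graph: "complete_bipartite_digraph 1 k (with_proj (star_graph k))"
proof -
  have "graph (with_proj (star_graph k))"
    using pair_graph_star_graph by (rule pair_graph.pair_graphD_graph)
  thus ?thesis
    unfolding complete_bipartite_digraph_def
    by (intro conjI exI[of _ "{0}"] exI[of _ "{1..k}"])
      (auto simp: star_graph_def arcs_ends_conv)
qed

lemma pair_graph_edgeless_graph: "pair_graph (edgeless_graph k)"
  by unfold_locales (auto simp: edgeless_graph_def symmetric_conv)

end

theory Submission
  imports Defs
begin

text \<open>
  A residue is a zero-divisor modulo \<open>m\<close> exactly when it is not coprime to \<open>m\<close>, so two distinct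
  vertices are adjacent as soon as \<open>m\<close> divides their product and they share a nontrivial divisor with \<open>m\<close>. This
  turns suitable factorisations of \<open>m\<close> into triangles:
  \<^item> \<open>a * b\<close>, \<open>a * c\<close>, \<open>b * c\<close> if \<open>m = a * b * c\<close> with distinct factors \<open>a, b, c > 1\<close>;
  \<^item> \<open>x * n\<close>, \<open>2 * x * n\<close>, \<open>x\<close> if \<open>m = x * x * n\<close> with \<open>x \<ge> 3\<close> and \<open>n \<ge> 2\<close>;
  \<^item> \<open>x\<close>, \<open>2 * x\<close>, \<open>3 * x\<close> if \<open>m = x * x\<close> with \<open>x \<ge> 4\<close>;
  \<^item> \<open>2 * a * b\<close>, \<open>2 * a\<close>, \<open>2 * b\<close> if \<open>m = 4 * a * b\<close> with distinct \<open>a, b > 1\<close>.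

  A composite \<open>m\<close> without any such factorisation is \<open>4\<close>, \<open>8\<close>, \<open>9\<close>, \<open>4 * p\<close> for an odd prime \<open>p\<close>, or
  a product of two distinct primes (\<open>acyclic_tzd_graph_Z_modulus\<close>), and for these moduli the
  graph can be written down explicitly: it is \<open>P\<^sub>1\<close>, \<open>P\<^sub>3\<close>, \<open>P\<^sub>2\<close>, the star centred at \<open>2 * p\<close>
  together with the isolated vertices \<open>p\<close> and \<open>3 * p\<close>, and an edgeless graph, respectively.

  Conversely, in each of the graphs obtained a single vertex lies on every edge. This property is
  invariant under isomorphism and leaves no room for a cycle of length at least three, so a graph
  isomorphic to one of them is acyclic, and cycles need not be transported along isomorphisms.
\<close>

section \<open>Graphs whose edges share a vertex\<close>

definition has_hub :: "'a pair_pre_digraph \<Rightarrow> bool" where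
  "has_hub G \<longleftrightarrow> (\<exists>c. \<forall>(u, v) \<in> parcs G. u = c \<or> v = c)"

text \<open>
  A vertex of a cycle lies on only two of its edges, so the first three edges of a cycle cannot all
  contain the hub.
\<close>
lemma has_hub_imp_acyclic_graph:
  assumes "has_hub G"
  shows "acyclic_graph G"
  unfolding acyclic_graph_def
proof
  obtain c where c: "\<And>u v. (u, v) \<in> parcs G \<Longrightarrow> u = c \<or> v = c"
    using assms by (auto simp: has_hub_def)
  assume "\<exists>p. pre_digraph.cycle (with_proj G) p \<and> 3 \<le> length p"
  then obtain p u where "3 \<le> length p" "set p \<subseteq> parcs G" "pcas u p u"
    and dist: "distinct (tl (pawalk_verts u p))"
    by (auto simp: pre_digraph.cycle_def pre_digraph.awalk_def cas_with_proj_eq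
        awalk_verts_with_proj_eq)
  then obtain e1 e2 e3 es where p: "p = e1 # e2 # e3 # es"
    by (auto simp: numeral_3_eq_3 Suc_le_length_iff)
  obtain v w x where e: "e1 = (u, v)" "e2 = (v, w)" "e3 = (w, x)" and "pcas x es u"
    using \<open>pcas u p u\<close> unfolding p by (cases e1; cases e2; cases e3) auto
  \<comment> \<open>Only the tail of the vertex list is known to be distinct. The start vertex \<open>u\<close> reappears as the
    last vertex, which separates it from \<open>v\<close> and \<open>w\<close>; for a triangle \<open>x = u\<close>.\<close>
  have "u \<in> set (pawalk_verts x es)"
    using \<open>pcas x es u\<close> by (induction es arbitrary: x) auto
  moreover have "x \<in> set (pawalk_verts x es)"
    using \<open>pcas x es u\<close> by (cases es) auto
  moreover have "distinct (v # w # pawalk_verts x es)"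
    using dist by (simp add: p e)
  ultimately have "u \<noteq> v" "u \<noteq> w" "v \<noteq> w" "v \<noteq> x"
    by auto
  moreover have "u = c \<or> v = c" "v = c \<or> w = c" "w = c \<or> x = c"
    using c \<open>set p \<subseteq> parcs G\<close> unfolding p e by auto
  ultimately show False
    by auto
qed

lemma graph_iso_has_hub:
  assumes "G \<cong>\<^sub>g H" "has_hub H"
  shows "has_hub G"
proof -
  obtain h where h: "pre_digraph.digraph_isomorphism (with_proj G) h"
    and H: "with_proj H = app_iso h (with_proj G)"
    using assms(1) by (auto simp: digraph_iso_def)
  have ends: "iso_tail h = fst" "iso_head h = snd" and arcs: "parcs H = iso_arcs h ` parcs G"
    using H by (auto simp: with_proj_def app_iso_def)
  interpret G: wf_digraph "with_proj G"
    using h by (simp add: pre_digraph.digraph_isomorphism_def)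
  have verts: "u \<in> pverts G" "v \<in> pverts G" if "(u, v) \<in> parcs G" for u v
    using G.tail_in_verts[of "(u, v)"] G.head_in_verts[of "(u, v)"] that by auto
  have image: "(iso_verts h u, iso_verts h v) \<in> parcs H" if "(u, v) \<in> parcs G" for u v
  proof -
    have "iso_arcs h (u, v) = (iso_verts h u, iso_verts h v)"
      using h that by (auto simp: pre_digraph.digraph_isomorphism_def ends prod_eq_iff)
    with arcs that show ?thesis
      by force
  qed
  obtain c where c: "\<And>u v. (u, v) \<in> parcs H \<Longrightarrow> u = c \<or> v = c"
    using assms(2) by (auto simp: has_hub_def)
  have inj: "inj_on (iso_verts h) (pverts G)"
    using h by (simp add: pre_digraph.digraph_isomorphism_def)
  \<comment> \<open>If no vertex is mapped to the hub \<open>c\<close>, then there are no edges, and the arbitrary value of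
    the inverse at \<open>c\<close> does no harm.\<close>
  have "u = the_inv_into (pverts G) (iso_verts h) c \<or> v = the_inv_into (pverts G) (iso_verts h) c"
    if "(u, v) \<in> parcs G" for u v
    using c[OF image[OF that]] verts[OF that] by (metis inj the_inv_into_f_f)
  thus ?thesis
    by (auto simp: has_hub_def)
qed

lemma has_hub_edgeless_graph: "has_hub (edgeless_graph k)"
  by (simp add: has_hub_def edgeless_graph_def)

lemma has_hub_path_graph:
  assumes "k \<le> 3"
  shows "has_hub (path_graph k)"
  unfolding has_hub_def using assms by (intro exI[of _ 1]) (auto simp: path_graph_def)

lemma has_hub_disjoint_union_star_edgeless:
  "has_hub (disjoint_union (star_graph k) (edgeless_graph n))"
  unfolding has_hub_def
  by (intro exI[of _ "Inl 0"]) (auto simp: disjoint_union_def star_graph_def edgeless_graph_def)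

lemma triangle_imp_not_acyclic_graph:
  assumes "pair_wf_digraph G"
    and "(u, v) \<in> parcs G" "(v, w) \<in> parcs G" "(w, u) \<in> parcs G"
    and "u \<noteq> v" "u \<noteq> w" "v \<noteq> w"
  shows "\<not> acyclic_graph G"
proof -
  interpret pair_wf_digraph G
    by fact
  have "cycle [(u, v), (v, w), (w, u)]"
    using assms(2-) in_arcsD1[OF assms(2)] by (auto simp: cycle_def awalk_def)
  thus ?thesis
    unfolding acyclic_graph_def by (intro notI) (metis One_nat_def Suc_eq_plus1 list.size(3,4)
      numeral_3_eq_3 order_refl)
qed

section \<open>Constructing isomorphisms of simple graphs\<close>

text \<open>
  Simple graphs have their endpoints as arcs, so an isomorphism is determined by its vertex map;
  preserving and reflecting adjacency takes the place of an explicit map on arcs.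
\<close>
lemma graph_isoI:
  assumes "pair_wf_digraph G" "pair_wf_digraph H"
    and bij: "bij_betw f (pverts G) (pverts H)"
    and arcs: "\<And>u v. u \<in> pverts G \<Longrightarrow> v \<in> pverts G \<Longrightarrow>
        (u, v) \<in> parcs G \<longleftrightarrow> (f u, f v) \<in> parcs H"
  shows "G \<cong>\<^sub>g H"
proof -
  interpret G: pair_wf_digraph G by fact
  interpret H: pair_wf_digraph H by fact
  have "parcs H = map_prod f f ` parcs G"
  proof (intro equalityI subsetI)
    fix e assume "e \<in> parcs H"
    obtain x y where e: "e = (x, y)"
      by (cases e)
    hence "x \<in> f ` pverts G" "y \<in> f ` pverts G"
      using \<open>e \<in> parcs H\<close> H.in_arcsD1 H.in_arcsD2 bij by (auto simp: bij_betw_def)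
    thus "e \<in> map_prod f f ` parcs G"
      using arcs \<open>e \<in> parcs H\<close> e by force
  next
    fix e assume "e \<in> map_prod f f ` parcs G"
    then obtain x y where "e = (f x, f y)" "(x, y) \<in> parcs G"
      by auto
    thus "e \<in> parcs H"
      using arcs[of x y] G.in_arcsD1[of x y] G.in_arcsD2[of x y] by simp
  qed
  moreover have "inj_on f (pverts G)" "pverts H = f ` pverts G"
    using bij by (auto simp: bij_betw_def)
  moreover have "inj_on (map_prod f f) (parcs G)"
  proof (rule inj_on_subset)
    show "inj_on (map_prod f f) (pverts G \<times> pverts G)"
      using \<open>inj_on f (pverts G)\<close> by (intro map_prod_inj_on)
    show "parcs G \<subseteq> pverts G \<times> pverts G"
      by (auto dest: G.in_arcsD1 G.in_arcsD2)
  qed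
  ultimately have
    "G.digraph_isomorphism \<lparr>iso_verts = f, iso_arcs = map_prod f f, iso_head = snd, iso_tail = fst\<rparr>"
    and "with_proj H = app_iso
      \<lparr>iso_verts = f, iso_arcs = map_prod f f, iso_head = snd, iso_tail = fst\<rparr> (with_proj G)"
    using G.wf_digraph_axioms
    by (simp_all add: G.digraph_isomorphism_def app_iso_def with_proj_def[of H])
  thus ?thesis
    unfolding digraph_iso_def by blast
qed

lemma graph_iso_edgeless_graphI:
  assumes "finite (pverts G)" "card (pverts G) = k" "parcs G = {}"
  shows "G \<cong>\<^sub>g edgeless_graph k"
proof -
  obtain f where "bij_betw f (pverts G) {..<k}"
    using assms(1,2) finite_same_card_bij[of "pverts G" "{..<k}"] by auto
  thus ?thesis
    using assms(3) by (intro graph_isoI[where f = f]) (unfold_locales, auto simp: edgeless_graph_def)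
qed

lemma graph_iso_disjoint_union_star_edgelessI:
  assumes "finite L" "card L = k" "finite I" "card I = n"
    and "c \<notin> L" "c \<notin> I" "L \<inter> I = {}"
    and pverts: "pverts G = insert c (L \<union> I)"
    and parcs: "parcs G = {c} \<times> L \<union> L \<times> {c}"
  shows "G \<cong>\<^sub>g disjoint_union (star_graph k) (edgeless_graph n)"
proof -
  obtain g where g: "bij_betw g L {1..k}"
    using assms(1,2) finite_same_card_bij[of L "{1..k}"] by auto
  obtain h where h: "bij_betw h I {..<n}"
    using assms(3,4) finite_same_card_bij[of I "{..<n}"] by auto
  define f where "f x = (if x = c then Inl 0 else if x \<in> L then Inl (g x) else Inr (h x))" for x
  have gL: "g x \<in> {1..k}" if "x \<in> L" for x
    using g that by (auto simp: bij_betw_def)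
  have fL: "f x = Inl (g x)" if "x \<in> L" for x
    using that \<open>c \<notin> L\<close> by (auto simp: f_def)
  have fI: "f x = Inr (h x)" if "x \<in> I" for x
    using that \<open>c \<notin> I\<close> \<open>L \<inter> I = {}\<close> by (auto simp: f_def)
  have "bij_betw (Inl \<circ> g) L (Inl ` {1..k})"
    by (rule bij_betw_trans[OF g]) (simp add: bij_betw_def)
  hence L: "bij_betw f L (Inl ` {1..k})"
    using fL by (subst bij_betw_cong[of L f "Inl \<circ> g"]) auto
  have "bij_betw (Inr \<circ> h) I (Inr ` {..<n})"
    by (rule bij_betw_trans[OF h]) (simp add: bij_betw_def)
  hence I: "bij_betw f I (Inr ` {..<n})"
    using fI by (subst bij_betw_cong[of I f "Inr \<circ> h"]) auto
  have "bij_betw f {c} {Inl 0}"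
    by (simp add: f_def)
  hence "bij_betw f ({c} \<union> (L \<union> I)) ({Inl 0} \<union> (Inl ` {1..k} \<union> Inr ` {..<n}))"
    by (rule bij_betw_combine[OF _ bij_betw_combine[OF L I]]) auto
  hence "bij_betw f (pverts G) (insert (Inl 0) (Inl ` {1..k} \<union> Inr ` {..<n}))"
    by (simp add: pverts)
  moreover have "insert (Inl 0) (Inl ` {1..k} \<union> Inr ` {..<n}) =
      pverts (disjoint_union (star_graph k) (edgeless_graph n))"
    by (auto simp: disjoint_union_def star_graph_def edgeless_graph_def)
  ultimately have bij: "bij_betw f (pverts G) (pverts (disjoint_union (star_graph k) (edgeless_graph n)))"
    by simp
  show ?thesis
  proof (rule graph_isoI[OF _ _ bij])
    show "pair_wf_digraph G"
      by unfold_locales (auto simp: pverts parcs)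
    show "pair_wf_digraph (disjoint_union (star_graph k) (edgeless_graph n))"
      by unfold_locales (auto simp: disjoint_union_def star_graph_def edgeless_graph_def)
    show "(u, v) \<in> parcs G \<longleftrightarrow>
        (f u, f v) \<in> parcs (disjoint_union (star_graph k) (edgeless_graph n))"
      if "u \<in> pverts G" "v \<in> pverts G" for u v
    proof -
      have "f x = Inl 0 \<longleftrightarrow> x = c" "f x \<in> Inl ` {1..k} \<longleftrightarrow> x \<in> L" if "x \<in> pverts G" for x
        using that gL[of x] fL[of x] fI[of x] \<open>c \<notin> L\<close> by (auto simp: pverts f_def split: if_splits)
      moreover have "(x, y) \<in> parcs (disjoint_union (star_graph k) (edgeless_graph n)) \<longleftrightarrow>
          x = Inl 0 \<and> y \<in> Inl ` {1..k} \<or> x \<in> Inl ` {1..k} \<and> y = Inl 0" for x y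
        by (auto simp: disjoint_union_def star_graph_def edgeless_graph_def)
      ultimately show ?thesis
        using that by (auto simp: parcs)
    qed
  qed
qed

lemma pair_wf_digraph_path_graph: "pair_wf_digraph (path_graph k)"
  by unfold_locales (auto simp: path_graph_def)

section \<open>Zero-divisors and edges modulo \<open>m\<close>\<close>

text \<open>
  If \<open>d = gcd x m > 1\<close>, then \<open>m div d\<close> is a nonzero residue that annihilates \<open>x\<close>; a residue
  coprime to \<open>m\<close> is cancellable.
\<close>
lemma zero_divisors_residue_ring_iff:
  assumes "1 < m"
  shows "x \<in> zero_divisors (residue_ring (int m)) \<longleftrightarrow> 0 \<le> x \<and> x < int m \<and> \<not> coprime x (int m)"
    (is "_ \<longleftrightarrow> ?R")
proof
  assume "x \<in> zero_divisors (residue_ring (int m))"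
  then consider "x = 0" | y where "0 \<le> x" "x < int m" "0 \<le> y" "y < int m" "y \<noteq> 0" "int m dvd x * y"
    by (auto simp: zero_divisors_def residue_ring_def mod_eq_0_iff_dvd)
  thus ?R
  proof cases
    case 1
    thus ?thesis using assms by auto
  next
    case 2
    hence "\<not> coprime x (int m)"
      by (metis coprime_commute coprime_dvd_mult_right_iff order_le_less zdvd_not_zless)
    with 2 show ?thesis by simp
  qed
next
  assume R: ?R
  define d where "d = gcd x (int m)"
  have "d > 1" "d dvd x" "d dvd int m"
  proof -
    have "0 < d" "d \<noteq> 1"
      using R assms by (auto simp: d_def coprime_iff_gcd_eq_1)
    thus "d > 1"
      by simp
  qed (simp_all add: d_def)
  then obtain a b where ab: "x = d * a" "int m = d * b"
    by (auto elim!: dvdE)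
  have "b > 0"
  proof -
    have "0 < d * b"
      using ab(2) assms by linarith
    thus ?thesis
      using \<open>d > 1\<close> by (simp add: zero_less_mult_iff)
  qed
  moreover have "b < int m"
    using ab(2) \<open>d > 1\<close> \<open>b > 0\<close> by simp
  moreover have "x * b = int m * a"
    by (simp add: ab)
  ultimately show "x \<in> zero_divisors (residue_ring (int m))"
    using R by (auto simp: zero_divisors_def residue_ring_def intro!: bexI[of _ b])
qed

lemma pverts_tzd_graph_Z:
  assumes "1 < m"
  shows "x \<in> pverts (tzd_graph_Z m) \<longleftrightarrow> 0 < x \<and> x < int m \<and> \<not> coprime x (int m)"
  using zero_divisors_residue_ring_iff[OF assms, of x] assms
  by (auto simp: total_zero_divisor_graph_def residue_ring_def)

lemma parcs_tzd_graph_Z: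
  assumes "1 < m"
  shows "(u, v) \<in> parcs (tzd_graph_Z m) \<longleftrightarrow>
      u \<in> pverts (tzd_graph_Z m) \<and> v \<in> pverts (tzd_graph_Z m) \<and> u \<noteq> v \<and>
      int m dvd u * v \<and> \<not> coprime (u + v) (int m)"
proof -
  have "(u + v) mod int m \<in> zero_divisors (residue_ring (int m)) \<longleftrightarrow> \<not> coprime (u + v) (int m)"
    using assms by (simp add: zero_divisors_residue_ring_iff)
  moreover have "u \<otimes>\<^bsub>residue_ring (int m)\<^esub> v = u * v mod int m"
    "u \<oplus>\<^bsub>residue_ring (int m)\<^esub> v = (u + v) mod int m"
    "\<zero>\<^bsub>residue_ring (int m)\<^esub> = 0"
    by (auto simp: residue_ring_def)
  ultimately show ?thesis
    by (auto simp: total_zero_divisor_graph_def mod_eq_0_iff_dvd)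
qed

lemma pair_wf_digraph_tzd_graph_Z: "1 < m \<Longrightarrow> pair_wf_digraph (tzd_graph_Z m)"
  using pair_graph_tzd_graph_Z[of m]
  by (simp add: pair_graph_def pair_digraph_def pair_fin_digraph_def)

lemma finite_pverts_tzd_graph_Z: "1 < m \<Longrightarrow> finite (pverts (tzd_graph_Z m))"
  by (rule finite_subset[of _ "{0..int m}"]) (auto simp: pverts_tzd_graph_Z)

text \<open>
  Nonzero residues modulo a prime are units, so a prime modulus yields the graph without vertices,
  which is acyclic without being one of the listed graphs.
\<close>
lemma not_prime_if_tzd_graph_Z_nonempty:
  assumes "1 < m" "pverts (tzd_graph_Z m) \<noteq> {}"
  shows "\<not> prime m"
proof
  assume "prime m"
  obtain x where x: "0 < x" "x < int m" "\<not> coprime x (int m)"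
    using assms by (auto simp: pverts_tzd_graph_Z)
  hence "int m dvd x"
    using \<open>prime m\<close> by (metis coprime_commute prime_imp_coprime prime_nat_int_transfer)
  thus False
    using x zdvd_imp_le by fastforce
qed

section \<open>Triangles\<close>

text \<open>
  A common divisor \<open>d\<close> of \<open>u\<close>, \<open>v\<close> and \<open>m\<close> makes \<open>u\<close>, \<open>v\<close> and \<open>u + v\<close> zero-divisors at once. In each
  of the triangles below it is visible from the factorisation of \<open>m\<close>.
\<close>
lemma tzd_graph_Z_arcI:
  fixes u v d m :: nat
  assumes "0 < u" "u < m" "0 < v" "v < m" "u \<noteq> v" "m dvd u * v"
    and "1 < d" "d dvd u" "d dvd v" "d dvd m"
  shows "(int u, int v) \<in> parcs (tzd_graph_Z m)"
proof -
  have "1 < m"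
    using assms(1,2) by simp
  have "\<not> coprime u m" "\<not> coprime v m" "\<not> coprime (u + v) m"
    using assms(7-) by (auto dest!: coprime_common_divisor_nat[of _ _ d])
  hence "\<not> coprime (int u) (int m)" "\<not> coprime (int v) (int m)" "\<not> coprime (int u + int v) (int m)"
    by (simp_all flip: of_nat_add)
  thus ?thesis
    using assms \<open>1 < m\<close>
    by (simp add: parcs_tzd_graph_Z pverts_tzd_graph_Z flip: of_nat_mult)
qed

lemma not_acyclic_tzd_graph_Z_if_triangle:
  fixes u v w m :: nat
  assumes "1 < m"
    and "(int u, int v) \<in> parcs (tzd_graph_Z m)" "(int v, int w) \<in> parcs (tzd_graph_Z m)"
      "(int w, int u) \<in> parcs (tzd_graph_Z m)"
  shows "\<not> acyclic_graph (tzd_graph_Z m)"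
  using assms pair_wf_digraph_tzd_graph_Z[OF assms(1)]
  by (intro triangle_imp_not_acyclic_graph[OF _ assms(2-4)]) (auto simp: parcs_tzd_graph_Z)

lemma not_acyclic_tzd_graph_Z_three_factors:
  fixes a b c :: nat
  assumes "1 < a" "1 < b" "1 < c" "a \<noteq> b" "a \<noteq> c" "b \<noteq> c"
  shows "\<not> acyclic_graph (tzd_graph_Z (a * b * c))"
proof (rule not_acyclic_tzd_graph_Z_if_triangle[of _ "a * b" "a * c" "b * c"])
  show "1 < a * b * c"
    using assms by (intro less_1_mult)
  show "(int (a * b), int (a * c)) \<in> parcs (tzd_graph_Z (a * b * c))"
    using assms by (intro tzd_graph_Z_arcI[where d = a]) (auto simp: ac_simps)
  show "(int (a * c), int (b * c)) \<in> parcs (tzd_graph_Z (a * b * c))"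
    using assms by (intro tzd_graph_Z_arcI[where d = c]) (auto simp: ac_simps)
  show "(int (b * c), int (a * b)) \<in> parcs (tzd_graph_Z (a * b * c))"
    using assms by (intro tzd_graph_Z_arcI[where d = b]) (auto simp: ac_simps)
qed

lemma not_acyclic_tzd_graph_Z_square_factor:
  fixes x n :: nat
  assumes "3 \<le> x" "2 \<le> n"
  shows "\<not> acyclic_graph (tzd_graph_Z (x * x * n))"
proof (rule not_acyclic_tzd_graph_Z_if_triangle[of _ "x * n" "2 * x * n" x])
  have x: "x * n < x * x * n" "2 * x * n < x * x * n" "x < x * n" "1 < n * x"
    using assms less_1_mult[of n x] by auto
  show "1 < x * x * n"
    using x assms by linarith
  show "(int (x * n), int (2 * x * n)) \<in> parcs (tzd_graph_Z (x * x * n))"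
    using assms x by (intro tzd_graph_Z_arcI[where d = x]) (auto intro: dvdI[of _ _ "2 * n"])
  show "(int (2 * x * n), int x) \<in> parcs (tzd_graph_Z (x * x * n))"
    using assms x
    by (intro tzd_graph_Z_arcI[where d = x]) (auto intro: dvdI[of _ _ 2] simp: ac_simps)
  show "(int x, int (x * n)) \<in> parcs (tzd_graph_Z (x * x * n))"
    using assms x by (intro tzd_graph_Z_arcI[where d = x]) (auto simp: ac_simps)
qed

lemma not_acyclic_tzd_graph_Z_square:
  fixes x :: nat
  assumes "4 \<le> x"
  shows "\<not> acyclic_graph (tzd_graph_Z (x * x))"
proof (rule not_acyclic_tzd_graph_Z_if_triangle[of _ x "2 * x" "3 * x"])
  have x: "3 * x < x * x"
    using assms by simp
  show "1 < x * x"
    using x assms by linarith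
  show "(int x, int (2 * x)) \<in> parcs (tzd_graph_Z (x * x))"
    using assms x by (intro tzd_graph_Z_arcI[where d = x]) auto
  show "(int (2 * x), int (3 * x)) \<in> parcs (tzd_graph_Z (x * x))"
    using assms x by (intro tzd_graph_Z_arcI[where d = x]) auto
  show "(int (3 * x), int x) \<in> parcs (tzd_graph_Z (x * x))"
    using assms x by (intro tzd_graph_Z_arcI[where d = x]) auto
qed

lemma not_acyclic_tzd_graph_Z_four_times:
  fixes a b :: nat
  assumes "1 < a" "1 < b" "a \<noteq> b"
  shows "\<not> acyclic_graph (tzd_graph_Z (4 * a * b))"
proof (rule not_acyclic_tzd_graph_Z_if_triangle[of _ "2 * a * b" "2 * a" "2 * b"])
  have x: "a < a * b" "b < a * b"
    using assms by auto
  show "1 < 4 * a * b"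
    using x assms by linarith
  show "(int (2 * a * b), int (2 * a)) \<in> parcs (tzd_graph_Z (4 * a * b))"
    using assms x by (intro tzd_graph_Z_arcI[where d = 2]) (auto intro: dvdI[of _ _ a])
  show "(int (2 * a), int (2 * b)) \<in> parcs (tzd_graph_Z (4 * a * b))"
    using assms x by (intro tzd_graph_Z_arcI[where d = 2]) auto
  show "(int (2 * b), int (2 * a * b)) \<in> parcs (tzd_graph_Z (4 * a * b))"
    using assms x by (intro tzd_graph_Z_arcI[where d = 2]) (auto intro: dvdI[of _ _ b])
qed

section \<open>The acyclic moduli\<close>

lemma coprime_prime_power_iff:
  fixes p x :: int
  assumes "prime p" "0 < k"
  shows "coprime x (p ^ k) \<longleftrightarrow> \<not> p dvd x"
proof -
  have "coprime x p \<longleftrightarrow> \<not> p dvd x"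
    using assms(1) by (metis coprime_absorb_left coprime_commute not_prime_unit prime_imp_coprime)
  thus ?thesis
    using assms(2) by simp
qed

lemma tzd_graph_Z_4: "tzd_graph_Z 4 \<cong>\<^sub>g path_graph 1"
proof -
  have "coprime x 4 \<longleftrightarrow> odd x" for x :: int
    using coprime_prime_power_iff[of 2 2 x] by simp
  hence "x \<in> pverts (tzd_graph_Z 4) \<longleftrightarrow> x \<in> {2}" for x
    using pverts_tzd_graph_Z[of 4 x] by simp presburger
  hence verts: "pverts (tzd_graph_Z 4) = {2}"
    by blast
  hence "parcs (tzd_graph_Z 4) = {}"
    using parcs_tzd_graph_Z[of 4] by auto
  hence "tzd_graph_Z 4 \<cong>\<^sub>g edgeless_graph 1"
    using verts by (intro graph_iso_edgeless_graphI) simp_all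
  also have "edgeless_graph 1 = path_graph 1"
    by (auto simp: edgeless_graph_def path_graph_def)
  finally show ?thesis .
qed

lemma tzd_graph_Z_9: "tzd_graph_Z 9 \<cong>\<^sub>g path_graph 2"
proof (rule graph_isoI[where f = "\<lambda>x. nat (x div 3) - 1"])
  have "prime (3::int)"
    by simp
  hence coprime_9: "coprime x 9 \<longleftrightarrow> \<not> 3 dvd x" for x :: int
    using coprime_prime_power_iff[of 3 2 x] by simp
  hence "x \<in> pverts (tzd_graph_Z 9) \<longleftrightarrow> x \<in> {3, 6}" for x
    using pverts_tzd_graph_Z[of 9 x] by simp presburger
  hence verts: "pverts (tzd_graph_Z 9) = {3, 6}"
    by blast
  show "bij_betw (\<lambda>x. nat (x div 3) - 1) (pverts (tzd_graph_Z 9)) (pverts (path_graph 2))"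
    unfolding verts by (auto simp: bij_betw_def path_graph_def)
  show "(u, v) \<in> parcs (tzd_graph_Z 9) \<longleftrightarrow>
      (nat (u div 3) - 1, nat (v div 3) - 1) \<in> parcs (path_graph 2)"
    if "u \<in> pverts (tzd_graph_Z 9)" "v \<in> pverts (tzd_graph_Z 9)" for u v
  proof -
    have "(u, v) \<in> parcs (tzd_graph_Z 9) \<longleftrightarrow> u \<noteq> v \<and> 9 dvd u * v \<and> 3 dvd u + v"
      using that parcs_tzd_graph_Z[of 9 u v] coprime_9[of "u + v"] by simp
    moreover have "u \<in> {3, 6}" "v \<in> {3, 6}"
      using that verts by blast+
    ultimately show ?thesis
      by (elim insertE emptyE) (simp_all add: path_graph_def)
  qed
qed (rule pair_wf_digraph_tzd_graph_Z pair_wf_digraph_path_graph, simp?)+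

lemma tzd_graph_Z_8: "tzd_graph_Z 8 \<cong>\<^sub>g path_graph 3"
proof (rule graph_isoI[where f = "\<lambda>x. nat (x div 2) - 1"])
  have coprime_8: "coprime x 8 \<longleftrightarrow> odd x" for x :: int
    using coprime_prime_power_iff[of 2 3 x] by simp
  hence "x \<in> pverts (tzd_graph_Z 8) \<longleftrightarrow> x \<in> {2, 4, 6}" for x
    using pverts_tzd_graph_Z[of 8 x] by simp presburger
  hence verts: "pverts (tzd_graph_Z 8) = {2, 4, 6}"
    by blast
  show "bij_betw (\<lambda>x. nat (x div 2) - 1) (pverts (tzd_graph_Z 8)) (pverts (path_graph 3))"
    unfolding verts by (auto simp: bij_betw_def path_graph_def)
  show "(u, v) \<in> parcs (tzd_graph_Z 8) \<longleftrightarrow>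
      (nat (u div 2) - 1, nat (v div 2) - 1) \<in> parcs (path_graph 3)"
    if "u \<in> pverts (tzd_graph_Z 8)" "v \<in> pverts (tzd_graph_Z 8)" for u v
  proof -
    have "(u, v) \<in> parcs (tzd_graph_Z 8) \<longleftrightarrow> u \<noteq> v \<and> 8 dvd u * v \<and> even (u + v)"
      using that parcs_tzd_graph_Z[of 8 u v] coprime_8[of "u + v"] by simp
    moreover have "u \<in> {2, 4, 6}" "v \<in> {2, 4, 6}"
      using that verts by blast+
    ultimately show ?thesis
      by (elim insertE emptyE) (simp_all add: path_graph_def)
  qed
qed (rule pair_wf_digraph_tzd_graph_Z pair_wf_digraph_path_graph, simp?)+

text \<open>
  If the product of two vertices is \<open>0\<close>, then one of them is a multiple of \<open>p\<close> only and the other of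
  \<open>q\<close> only, which makes their sum a unit. Hence there are no edges, and the vertices are the \<open>q - 1\<close>
  nonzero multiples of \<open>p\<close> and the \<open>p - 1\<close> nonzero multiples of \<open>q\<close>.
\<close>
lemma tzd_graph_Z_prod_two_primes:
  fixes p q :: nat
  assumes p: "prime p" and q: "prime q" and "p \<noteq> q"
  shows "tzd_graph_Z (p * q) \<cong>\<^sub>g edgeless_graph (p + q - 2)"
proof -
  define G where "G = tzd_graph_Z (p * q)"
  have pq: "1 < p" "1 < q"
    using prime_gt_1_nat[OF p] prime_gt_1_nat[OF q] by auto
  hence m: "1 < p * q"
    by (rule less_1_mult)
  have ip: "prime (int p)" "prime (int q)" "coprime (int p) (int q)"
    using assms by (auto simp: primes_coprime)
  have "\<not> coprime x (int (p * q)) \<longleftrightarrow> int p dvd x \<or> int q dvd x" for x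
    using coprime_prime_power_iff[of "int p" 1 x] coprime_prime_power_iff[of "int q" 1 x] ip
    by simp
  hence vert: "x \<in> pverts G \<longleftrightarrow> 0 < x \<and> x < int p * int q \<and> (int p dvd x \<or> int q dvd x)"
    and arc: "(x, y) \<in> parcs G \<longleftrightarrow> x \<in> pverts G \<and> y \<in> pverts G \<and> x \<noteq> y \<and>
      int p * int q dvd x * y \<and> (int p dvd x + y \<or> int q dvd x + y)" for x y
    unfolding G_def pverts_tzd_graph_Z[OF m] parcs_tzd_graph_Z[OF m] by simp_all
  have not_both: False if "x \<in> pverts G" "int p dvd x" "int q dvd x" for x
  proof -
    have "int p * int q dvd x"
      using that ip by (simp add: divides_mult)
    with that(1) show False
      by (simp add: vert zdvd_not_zless)
  qed
  have no_arc: False if "(u, v) \<in> parcs G" for u v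
  proof -
    have uv: "u \<in> pverts G" "v \<in> pverts G" "int p dvd u + v \<or> int q dvd u + v"
      and "int p dvd u * v" "int q dvd u * v"
      using that by (auto simp: arc dest: dvd_mult_left dvd_mult_right)
    hence "int p dvd u \<or> int p dvd v" "int q dvd u \<or> int q dvd v"
      using ip by (simp_all add: prime_dvd_mult_iff)
    thus False
      using uv not_both by (metis dvd_add_right_iff dvd_add_left_iff)
  qed
  have verts: "pverts G = (\<lambda>k. int (p * k)) ` {1..<q} \<union> (\<lambda>k. int (q * k)) ` {1..<p}"
    (is "_ = ?A \<union> ?B")
  proof (intro equalityI subsetI)
    fix x assume "x \<in> pverts G"
    hence x: "0 < x" "x < int p * int q" "int p dvd x \<or> int q dvd x"
      by (auto simp: vert)
    then obtain n where n: "x = int n"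
      by (metis zero_less_imp_eq_int)
    hence n': "0 < n" "n < p * q" "p dvd n \<or> q dvd n"
      using x by (simp_all flip: of_nat_mult)
    from n'(3) show "x \<in> ?A \<union> ?B"
    proof
      assume "p dvd n"
      then obtain k where k: "n = p * k"
        by (auto simp: dvd_def)
      hence "k \<in> {1..<q}"
        using n'(1,2) by (simp add: Suc_le_eq)
      thus ?thesis
        by (auto simp: n k)
    next
      assume "q dvd n"
      then obtain k where k: "n = q * k"
        by (auto simp: dvd_def)
      hence "k \<in> {1..<p}"
        using n'(1,2) by (simp add: Suc_le_eq mult.commute[of p])
      thus ?thesis
        by (auto simp: n k)
    qed
  next
    fix x assume "x \<in> ?A \<union> ?B"
    moreover have "int p * int k \<in> pverts G" if "k \<in> {1..<q}" for k
      using that pq by (simp add: vert)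
    moreover have "int q * int k \<in> pverts G" if "k \<in> {1..<p}" for k
      using that pq by (simp add: vert mult.commute[of "int p"])
    ultimately show "x \<in> pverts G"
      by auto
  qed
  have "?A \<inter> ?B = {}"
  proof -
    have False if "x \<in> ?A" "x \<in> ?B" for x
    proof (rule not_both)
      show "x \<in> pverts G"
        using that(1) verts by blast
      show "int p dvd x"
        using that(1) by auto
      show "int q dvd x"
        using that(2) by auto
    qed
    thus ?thesis
      by blast
  qed
  moreover have "card ?A = q - 1" "card ?B = p - 1"
    using pq by (simp_all add: card_image inj_on_def)
  ultimately have "card (pverts G) = p + q - 2"
    unfolding verts using pq by (subst card_Un_disjoint) auto
  moreover have "parcs G = {}"
    using no_arc by auto
  moreover have "finite (pverts G)"
    unfolding verts by simp
  ultimately show ?thesis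
    unfolding G_def by (intro graph_iso_edgeless_graphI)
qed

text \<open>
  The vertices are the nonzero even residues together with \<open>p\<close> and \<open>3 * p\<close>. An even vertex that is a
  multiple of \<open>p\<close> can only be \<open>2 * p\<close>, so two distinct even vertices have product \<open>0\<close> exactly when
  one of them is \<open>2 * p\<close>. The odd vertices are isolated: their product is odd, and an even neighbour
  would have to be a multiple of \<open>p\<close> as well for the sum to be a zero-divisor, hence equal to
  \<open>2 * p\<close>, which annihilates no odd residue.
\<close>
lemma tzd_graph_Z_four_times_odd_prime:
  fixes p :: nat
  assumes p: "prime p" and "p \<noteq> 2"
  shows "tzd_graph_Z (4 * p) \<cong>\<^sub>g disjoint_union (star_graph (2 * p - 2)) (edgeless_graph 2)"
proof -
  define G where "G = tzd_graph_Z (4 * p)"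
  have "2 < p"
    using assms prime_ge_2_nat[of p] by linarith
  have "odd p"
    using assms prime_odd_nat \<open>2 < p\<close> by blast
  have m: "1 < 4 * p"
    using \<open>2 < p\<close> by simp
  have ip: "prime (int p)" "odd (int p)"
    using p \<open>odd p\<close> by auto
  have "\<not> coprime x (int (4 * p)) \<longleftrightarrow> even x \<or> int p dvd x" for x
    using coprime_prime_power_iff[of 2 2 x] coprime_prime_power_iff[of "int p" 1 x] ip by simp
  hence vert: "x \<in> pverts G \<longleftrightarrow> 0 < x \<and> x < 4 * int p \<and> (even x \<or> int p dvd x)"
    and arc: "(x, y) \<in> parcs G \<longleftrightarrow> x \<in> pverts G \<and> y \<in> pverts G \<and> x \<noteq> y \<and>
      4 * int p dvd x * y \<and> (even (x + y) \<or> int p dvd x + y)" for x y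
    unfolding G_def pverts_tzd_graph_Z[OF m] parcs_tzd_graph_Z[OF m] by simp_all
  define c where "c = 2 * int p"
  define L where "L = (\<lambda>k. 2 * k) ` ({1..<2 * int p} - {int p})"
  define I where "I = {int p, 3 * int p}"
  have L_in: "x \<in> L \<longleftrightarrow> 0 < x \<and> x < 4 * int p \<and> even x \<and> x \<noteq> c" for x
    by (auto simp: L_def c_def elim!: evenE)
  have multiple_p: "x \<in> {int p, c, 3 * int p}" if x: "int p dvd x" "0 < x" "x < 4 * int p" for x
  proof -
    obtain k where k: "x = int p * k"
      using x(1) by (auto simp: dvd_def)
    hence "int p * 0 < int p * k" "int p * k < int p * 4"
      using x by linarith+
    hence "0 < k" "k < 4"
      by (simp_all only: mult_less_cancel_left)
    hence "k = 1 \<or> k = 2 \<or> k = 3"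
      by linarith
    thus ?thesis
      by (auto simp: k c_def)
  qed
  have I_in: "x \<in> I \<longleftrightarrow> 0 < x \<and> x < 4 * int p \<and> odd x \<and> int p dvd x" for x
    using multiple_p[of x] \<open>2 < p\<close> ip by (auto simp: I_def c_def)
  have c_in: "0 < c" "c < 4 * int p" "even c" "int p dvd c"
    using \<open>2 < p\<close> by (auto simp: c_def)
  have even_multiple_p: "x = c" if "even x" "int p dvd x" "0 < x" "x < 4 * int p" for x
    using multiple_p[of x] that ip by auto
  have verts: "pverts G = insert c (L \<union> I)"
    using c_in by (auto simp: vert L_in I_in)
  have c_arc: "4 * int p dvd c * x \<longleftrightarrow> even x" "4 * int p dvd x * c \<longleftrightarrow> even x" for x
  proof -
    have "2 * int p * 2 dvd 2 * int p * x \<longleftrightarrow> even x"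
      using \<open>2 < p\<close> by (simp only: dvd_times_left_cancel_iff)
    thus "4 * int p dvd c * x \<longleftrightarrow> even x"
      by (simp add: c_def)
    thus "4 * int p dvd x * c \<longleftrightarrow> even x"
      by (simp only: mult.commute)
  qed
  have arcs: "(u, v) \<in> parcs G \<longleftrightarrow> u = c \<and> v \<in> L \<or> u \<in> L \<and> v = c" for u v
  proof
    assume "(u, v) \<in> parcs G"
    hence uv: "0 < u" "u < 4 * int p" "0 < v" "v < 4 * int p" "u \<noteq> v" "4 * int p dvd u * v"
      "even (u + v) \<or> int p dvd u + v"
      by (auto simp: arc vert)
    have "even (u * v)" "int p dvd u * v"
      using uv(6) by (rule dvd_trans[rotated], simp)+
    hence pdvd: "int p dvd u \<or> int p dvd v" and ev: "even u \<or> even v"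
      using ip by (simp_all add: prime_dvd_mult_iff)
    have "even u \<and> even v"
    proof (rule ccontr)
      assume odd: "\<not> (even u \<and> even v)"
      with ev have "odd (u + v)"
        by auto
      hence "int p dvd u + v"
        using uv(7) by simp
      hence "int p dvd u \<longleftrightarrow> int p dvd v"
        by (metis dvd_add_left_iff dvd_add_right_iff)
      hence "int p dvd u" "int p dvd v"
        using pdvd by auto
      hence "u = c \<and> odd v \<or> v = c \<and> odd u"
        using even_multiple_p uv(1-4) ev odd by blast
      thus False
        using uv(6) c_arc by blast
    qed
    thus "u = c \<and> v \<in> L \<or> u \<in> L \<and> v = c"
      using pdvd even_multiple_p[of u] even_multiple_p[of v] uv(1-5) by (auto simp: L_in)
  next
    assume "u = c \<and> v \<in> L \<or> u \<in> L \<and> v = c"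
    thus "(u, v) \<in> parcs G"
      using c_in by (auto simp: arc vert L_in c_arc)
  qed
  have "G \<cong>\<^sub>g disjoint_union (star_graph (2 * p - 2)) (edgeless_graph 2)"
  proof (rule graph_iso_disjoint_union_star_edgelessI[OF _ _ _ _ _ _ _ verts])
    show "finite L" "finite I" "card I = 2"
      using \<open>2 < p\<close> by (auto simp: L_def I_def)
    show "c \<notin> L" "c \<notin> I" "L \<inter> I = {}"
      using c_in by (auto simp: L_in I_in)
    have "card L = card ({1..<2 * int p} - {int p})"
      unfolding L_def by (intro card_image) (auto simp: inj_on_def)
    also have "\<dots> = 2 * p - 2"
      using \<open>2 < p\<close> by simp
    finally show "card L = 2 * p - 2" .
    show "parcs G = {c} \<times> L \<union> L \<times> {c}"
      using arcs by auto
  qed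
  thus ?thesis
    by (simp only: G_def)
qed

text \<open>
  If \<open>m\<close> is a product of two equal primes, these are less than \<open>4\<close>. If \<open>m\<close> has more than two prime
  factors, split off two of them, \<open>m = p * q * s\<close> with \<open>s > 1\<close>. Three distinct factors give a
  triangle, so \<open>m = x * x * k\<close> with \<open>x\<close> prime and \<open>k > 1\<close>; then \<open>x = 2\<close>, and \<open>k\<close> is prime because a
  composite \<open>k\<close> again gives a triangle.
\<close>
lemma acyclic_tzd_graph_Z_modulus:
  assumes "1 < m" "\<not> prime m" "acyclic_graph (tzd_graph_Z m)"
  shows "m \<in> {4, 8, 9} \<or> (\<exists>p. prime p \<and> p \<noteq> 2 \<and> m = 4 * p) \<or>
    (\<exists>p q. prime p \<and> prime q \<and> p \<noteq> q \<and> m = p * q)"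
proof -
  obtain p n where p: "prime p" and m: "m = p * n"
    using assms(1) prime_factor_nat[of m] by (auto elim!: dvdE)
  have "1 < n"
    using assms(1,2) p m by (cases n rule: linorder_cases[of _ 1]) auto
  have square: "x = 2 \<and> (k = 2 \<or> prime k)"
    if x: "prime x" and k: "1 < k" and mx: "m = x * x * k" for x k
  proof
    have "\<not> 3 \<le> x"
      using not_acyclic_tzd_graph_Z_square_factor[of x k] k mx assms(3) by auto
    thus "x = 2"
      using prime_ge_2_nat[OF x] by linarith
    show "k = 2 \<or> prime k"
    proof (rule ccontr)
      assume nk: "\<not> (k = 2 \<or> prime k)"
      obtain a b where a: "prime a" and kab: "k = a * b"
        using k prime_factor_nat[of k] by (auto elim!: dvdE)
      have "1 < b"
        using k nk a kab by (cases b rule: linorder_cases[of _ 1]) auto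
      show False
      proof (cases "a = b")
        case False
        thus False
          using not_acyclic_tzd_graph_Z_four_times[of a b] prime_gt_1_nat[OF a] \<open>1 < b\<close> assms(3)
            mx \<open>x = 2\<close> kab
          by (simp add: mult.assoc)
      next
        case True
        \<comment> \<open>Now \<open>m = a * a * 4\<close>, where \<open>a\<close> takes over the role of \<open>x\<close> unless \<open>m = 4 * 4\<close>.\<close>
        show False
        proof (cases "a = 2")
          case True
          hence "m = 4 * 4"
            using mx \<open>x = 2\<close> kab \<open>a = b\<close> by simp
          thus False
            using not_acyclic_tzd_graph_Z_square[of 4] assms(3) by simp
        next
          case False
          hence "3 \<le> a"
            using prime_ge_2_nat[OF a] by linarith
          thus False
            using not_acyclic_tzd_graph_Z_square_factor[of a 4] assms(3) mx \<open>x = 2\<close> kab \<open>a = b\<close>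
            by (simp add: ac_simps)
        qed
      qed
    qed
  qed
  have square': ?thesis if "prime x" "1 < k" "m = x * x * k" for x k
    using square[OF that] that(3) by auto
  show ?thesis
  proof (cases "prime n")
    case True
    show ?thesis
    proof (cases "p = n")
      case True
      hence "\<not> 4 \<le> p"
        using not_acyclic_tzd_graph_Z_square[of p] m assms(3) by auto
      hence "p = 2 \<or> p = 3"
        using prime_ge_2_nat[OF p] by linarith
      thus ?thesis
        using True m by auto
    qed (use p True m in blast)
  next
    case False
    obtain q s where q: "prime q" and n: "n = q * s"
      using \<open>1 < n\<close> prime_factor_nat[of n] by (auto elim!: dvdE)
    have "1 < s"
      using \<open>1 < n\<close> False q n by (cases s rule: linorder_cases[of _ 1]) auto
    have "p = q \<or> p = s \<or> q = s"
      using not_acyclic_tzd_graph_Z_three_factors[of p q s] prime_gt_1_nat[OF p] prime_gt_1_nat[OF q]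
        \<open>1 < s\<close> assms(3)
      by (auto simp: m n mult.assoc)
    then consider "m = p * p * s" | "m = p * p * q" | "m = q * q * p"
      by (auto simp: m n)
    thus ?thesis
      using square' p q \<open>1 < s\<close> prime_gt_1_nat by cases blast+
  qed
qed

theorem corollary4p1:
  shows "(\<forall>m::nat. 1 < m \<and> pverts (tzd_graph_Z m) \<noteq> {} \<longrightarrow>
            (acyclic_graph (tzd_graph_Z m) \<longleftrightarrow>
               tzd_graph_Z m \<cong>\<^sub>g path_graph 1 \<or>
               tzd_graph_Z m \<cong>\<^sub>g path_graph 2 \<or>
               tzd_graph_Z m \<cong>\<^sub>g path_graph 3 \<or>
               (\<exists>p q :: nat. prime p \<and> prime q \<and> p \<noteq> q \<and>
                  (tzd_graph_Z m \<cong>\<^sub>g disjoint_union (star_graph (2 * p - 2)) (edgeless_graph 2) \<or>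
                   tzd_graph_Z m \<cong>\<^sub>g edgeless_graph (p + q - 2))))) \<and>
         (\<exists>m>1. tzd_graph_Z m \<cong>\<^sub>g path_graph 1) \<and>
         (\<exists>m>1. tzd_graph_Z m \<cong>\<^sub>g path_graph 2) \<and>
         (\<exists>m>1. tzd_graph_Z m \<cong>\<^sub>g path_graph 3) \<and>
         (\<forall>p::nat. prime p \<and> p \<noteq> 2 \<longrightarrow>
            (\<exists>m>1. tzd_graph_Z m \<cong>\<^sub>g disjoint_union (star_graph (2 * p - 2)) (edgeless_graph 2))) \<and>
         (\<forall>p q :: nat. prime p \<and> prime q \<and> p \<noteq> q \<longrightarrow>
            (\<exists>m>1. tzd_graph_Z m \<cong>\<^sub>g edgeless_graph (p + q - 2)))"
proof (intro conjI allI impI, goal_cases)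
  case (1 m)
  let ?G = "tzd_graph_Z m"
  let ?listed = "?G \<cong>\<^sub>g path_graph 1 \<or> ?G \<cong>\<^sub>g path_graph 2 \<or> ?G \<cong>\<^sub>g path_graph 3 \<or>
    (\<exists>p q :: nat. prime p \<and> prime q \<and> p \<noteq> q \<and>
      (?G \<cong>\<^sub>g disjoint_union (star_graph (2 * p - 2)) (edgeless_graph 2) \<or>
       ?G \<cong>\<^sub>g edgeless_graph (p + q - 2)))"
  show "acyclic_graph ?G \<longleftrightarrow> ?listed"
  proof
    assume "acyclic_graph ?G"
    moreover have "\<not> prime m"
      using 1 not_prime_if_tzd_graph_Z_nonempty by blast
    ultimately consider "m \<in> {4, 8, 9}" | p where "prime p" "p \<noteq> 2" "m = 4 * p"
      | p q where "prime p" "prime q" "p \<noteq> q" "m = p * q"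
      using acyclic_tzd_graph_Z_modulus[of m] 1 by blast
    thus ?listed
    proof cases
      case 1
      thus ?thesis
        using tzd_graph_Z_4 tzd_graph_Z_8 tzd_graph_Z_9 by auto
    next
      case 2
      \<comment> \<open>The star depends on \<open>p\<close> alone; \<open>2\<close> serves as the second prime, distinct from \<open>p\<close>.\<close>
      hence "prime (2::nat)" "?G \<cong>\<^sub>g disjoint_union (star_graph (2 * p - 2)) (edgeless_graph 2)"
        using tzd_graph_Z_four_times_odd_prime by auto
      with 2 show ?thesis
        by blast
    next
      case 3
      hence "?G \<cong>\<^sub>g edgeless_graph (p + q - 2)"
        using tzd_graph_Z_prod_two_primes by simp
      with 3 show ?thesis
        by blast
    qed
  next
    assume ?listed
    hence "has_hub ?G"
      by (elim disjE exE conjE) (rule graph_iso_has_hub, assumption,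
        simp add: has_hub_path_graph has_hub_edgeless_graph has_hub_disjoint_union_star_edgeless)+
    thus "acyclic_graph ?G"
      by (rule has_hub_imp_acyclic_graph)
  qed
next
  case 2
  show ?case
    using tzd_graph_Z_4 by (intro exI[of _ 4]) simp
next
  case 3
  show ?case
    using tzd_graph_Z_9 by (intro exI[of _ 9]) simp
next
  case 4
  show ?case
    using tzd_graph_Z_8 by (intro exI[of _ 8]) simp
next
  case (5 p)
  thus ?case
    using tzd_graph_Z_four_times_odd_prime[of p] prime_gt_1_nat[of p]
    by (intro exI[of _ "4 * p"]) simp
next
  case (6 p q)
  moreover from this have "1 < p * q"
    by (intro less_1_mult prime_gt_1_nat) auto
  ultimately show ?case
    using tzd_graph_Z_prod_two_primes[of p q] by blast
qed

end
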